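(* The bivalent bicyclic graphs are the bicyclic graphs composed of either (i) chains $P_2$ connected by equal links that form only two cycles (independent cycles, i.e. the resulting graph is bicyclic), with eigenvalue $\lambda=2$; or (ii) one even cycle with an additional equal link, with eigenvalue $\lambda=4$; or (iii) two even cycles connected by an equal link, with eigenvalue $\lambda=4$.
   Context: Graphs are finite, simple and undirected. A bicyclic graph is a connected graph with $n$ vertices and $n+1$ edges. The Laplacian of a graph $G$ is $L(G)=D-A$ ($D$ the diagonal matrix of degrees, $A$ the adjacency matrix). An eigenvector of $L(G)$ is bivalent if it is composed of the values $\{-1,+1\}$ (both values occurring). A graph is bivalent if its Laplacian has a bivalent eigenvector; the eigenvalue mentioned is the one afforded by that eigenvector. $P_2$ is the path on two vertices and carries the vector $[1,-1]^T$; an even cycle carries, in cyclic order, the alternating vector $[1,-1,\dots,1,-1]^T$. An equal link is an edge joining two vertices with the same value; connecting graphs carrying vectors by equal links means adding to their disjoint union edges between vertices having the same value in the combined vector, and an additional equal link on a cycle is a new edge joining two vertices of that cycle with the same value. *)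

theory Defs
  imports
    "Graph_Theory.Digraph_Component"
    "Jordan_Normal_Form.Char_Poly"
    "HOL-Library.Disjoint_Sets"
begin

text \<open>
  Finite simple undirected graphs are the \<^locale>\<open>pair_graph\<close>s of \<^theory>\<open>Graph_Theory.Pair_Digraph\<close>:
  an edge \<open>uv\<close> is the pair of opposite arcs \<open>(u,v)\<close>, \<open>(v,u)\<close>, so undirected edges have to be
  counted as unordered pairs.
\<close>

definition undirected_edges :: "'a pair_pre_digraph \<Rightarrow> 'a set set" where
  "undirected_edges G = {{u, v} | u v. (u, v) \<in> parcs G}"

definition bicyclic :: "'a pair_pre_digraph \<Rightarrow> bool" where
  "bicyclic G \<longleftrightarrow>
     pair_graph G \<and> Digraph_Component.connected (with_proj G) \<and>
     card (undirected_edges G) = card (pverts G) + 1"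

text \<open>The matrices below are those of a graph whose vertex set is \<open>{0..<n}\<close>; in a symmetric digraph
  the out-degree of a vertex is its degree in the undirected graph.\<close>

definition degree_matrix :: "nat pair_pre_digraph \<Rightarrow> real mat" where
  "degree_matrix G = mat (card (pverts G)) (card (pverts G))
     (\<lambda>(i, j). if i = j then real (out_degree (with_proj G) i) else 0)"

definition adjacency_matrix :: "nat pair_pre_digraph \<Rightarrow> real mat" where
  "adjacency_matrix G = mat (card (pverts G)) (card (pverts G))
     (\<lambda>(i, j). if (i, j) \<in> parcs G then 1 else 0)"

definition laplacian :: "nat pair_pre_digraph \<Rightarrow> real mat" where
  "laplacian G = degree_matrix G - adjacency_matrix G"

definition bivalent_eigenvector :: "nat pair_pre_digraph \<Rightarrow> real vec \<Rightarrow> real \<Rightarrow> bool" where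
  "bivalent_eigenvector G x l \<longleftrightarrow> eigenvector (laplacian G) x l \<and> set\<^sub>v x = {-1, 1}"

definition bivalent :: "nat pair_pre_digraph \<Rightarrow> bool" where
  "bivalent G \<longleftrightarrow> (\<exists>x l. bivalent_eigenvector G x l)"

text \<open>A graph \<open>H\<close> carrying a vector is a graph together with a labelling \<open>x\<close>, of which only the values
  on the vertices of \<open>H\<close> matter. A common labelling \<open>x\<close> of vertex-disjoint graphs
  is then the combined vector of their disjoint union.\<close>

definition P2_carrying :: "'a pair_pre_digraph \<Rightarrow> ('a \<Rightarrow> real) \<Rightarrow> bool" where
  "P2_carrying H x \<longleftrightarrow>
     (\<exists>u v. u \<noteq> v \<and> H = \<lparr>pverts = {u, v}, parcs = {(u, v), (v, u)}\<rparr> \<and> x u = 1 \<and> x v = -1)"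

definition cycle_graph :: "'a list \<Rightarrow> 'a pair_pre_digraph" where
  "cycle_graph vs = \<lparr>pverts = set vs,
     parcs = (\<Union>i<length vs. {(vs ! i, vs ! (Suc i mod length vs)),
                             (vs ! (Suc i mod length vs), vs ! i)})\<rparr>"

definition even_cycle_carrying :: "'a pair_pre_digraph \<Rightarrow> ('a \<Rightarrow> real) \<Rightarrow> bool" where
  "even_cycle_carrying H x \<longleftrightarrow>
     (\<exists>vs. distinct vs \<and> 3 \<le> length vs \<and> even (length vs) \<and> H = cycle_graph vs \<and>
           (\<forall>i<length vs. x (vs ! i) = (-1) ^ i))"

definition add_links :: "'a pair_pre_digraph set \<Rightarrow> 'a set set \<Rightarrow> 'a pair_pre_digraph" where
  "add_links \<H> F = \<lparr>pverts = (\<Union>H\<in>\<H>. pverts H),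
     parcs = (\<Union>H\<in>\<H>. parcs H) \<union> {(u, v). {u, v} \<in> F}\<rparr>"

text \<open>The links of chains \<open>P\<^sub>2\<close> are automatically new edges between different chains: the two
  vertices of one chain carry different values.\<close>

definition P2s_connected_by_equal_links :: "'a pair_pre_digraph \<Rightarrow> ('a \<Rightarrow> real) \<Rightarrow> bool" where
  "P2s_connected_by_equal_links G x \<longleftrightarrow>
     (\<exists>\<H> F. disjoint_family_on pverts \<H> \<and> (\<forall>H\<in>\<H>. P2_carrying H x) \<and>
            (\<forall>e\<in>F. \<exists>u\<in>\<Union>(pverts ` \<H>). \<exists>v\<in>\<Union>(pverts ` \<H>).
                      e = {u, v} \<and> u \<noteq> v \<and> x u = x v) \<and>
            G = add_links \<H> F)"

definition even_cycle_with_equal_link :: "'a pair_pre_digraph \<Rightarrow> ('a \<Rightarrow> real) \<Rightarrow> bool" where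
  "even_cycle_with_equal_link G x \<longleftrightarrow>
     (\<exists>C. even_cycle_carrying C x \<and>
          (\<exists>u\<in>pverts C. \<exists>v\<in>pverts C. u \<noteq> v \<and> (u, v) \<notin> parcs C \<and> x u = x v \<and>
             G = add_links {C} {{u, v}}))"

definition two_even_cycles_connected_by_equal_link ::
    "'a pair_pre_digraph \<Rightarrow> ('a \<Rightarrow> real) \<Rightarrow> bool" where
  "two_even_cycles_connected_by_equal_link G x \<longleftrightarrow>
     (\<exists>C1 C2. even_cycle_carrying C1 x \<and> even_cycle_carrying C2 x \<and> pverts C1 \<inter> pverts C2 = {} \<and>
          (\<exists>u\<in>pverts C1. \<exists>v\<in>pverts C2. x u = x v \<and> G = add_links {C1, C2} {{u, v}}))"

end

theory Submission
  imports Defs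
begin

text \<open>
  For a labelling with values \<open>\<plusminus>1\<close>, the Laplacian multiplies the entry at \<open>v\<close> by twice the
  number of neighbours of \<open>v\<close> with the opposite value. So a bivalent eigenvector for \<open>l\<close> is the same
  as a labelling with both values in which every vertex has exactly \<open>k = l / 2\<close> unlike neighbours.
  Connectedness forces \<open>k \<ge> 1\<close>, and counting arcs (\<open>n k \<le> 2 (n + 1)\<close> while \<open>k < n\<close>) forces
  \<open>k \<le> 2\<close>. For \<open>k = 1\<close> the unlike edges form a perfect matching. For \<open>k = 2\<close> they form a
  2-regular graph with \<open>n\<close> edges, so a single like edge remains; the unlike edges
  split into cycles along which the values alternate, and as one edge connects at most two components,
  there are at most two of them.
\<close>

subsection \<open>Cycles in 2-regular relations\<close>

text \<open>The bound 3 excludes the back-and-forth list \<open>[u, v]\<close> that any two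
  neighbours in a symmetric relation would give. Only inclusion in \<open>R\<close> is asked, so
  \<open>R\<close> may have further arcs at the vertices of \<open>vs\<close>.\<close>

definition cycle_in :: "'a rel \<Rightarrow> 'a list \<Rightarrow> bool" where
  "cycle_in R vs \<longleftrightarrow> distinct vs \<and> 3 \<le> length vs \<and>
     (\<forall>i<length vs. (vs ! i, vs ! (Suc i mod length vs)) \<in> R)"

text \<open>All neighbours of the first vertex of a longest path lie on the path; the farther of two of
  them closes the cycle.\<close>

lemma cycle_in_exists:
  assumes "finite V" "V \<noteq> {}" "R \<subseteq> V \<times> V" "sym R" "irrefl R"
    and deg: "\<And>v. v \<in> V \<Longrightarrow> 2 \<le> card (R `` {v})"
  obtains vs where "cycle_in R vs" "set vs \<subseteq> V"
proof -
  define path where "path p \<longleftrightarrow> p \<noteq> [] \<and> distinct p \<and> set p \<subseteq> V \<and>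
    (\<forall>i. Suc i < length p \<longrightarrow> (p ! i, p ! Suc i) \<in> R)" for p
  obtain v where "v \<in> V" using \<open>V \<noteq> {}\<close> by blast
  then have "path [v]" by (simp add: path_def)
  moreover have "length p \<le> card V" if "path p" for p
    using that card_mono[OF \<open>finite V\<close>, of "set p"] distinct_card[of p] by (simp add: path_def)
  \<comment> \<open>A path without repetition has at most \<open>card V\<close> vertices, so a
    longest one exists; \<open>Suc (card V)\<close> is the corresponding strict bound.\<close>
  ultimately have "\<exists>p. path p \<and> (\<forall>q. path q \<longrightarrow> length q \<le> length p)"
    using ex_has_greatest_nat[of path "[v]" length "Suc (card V)"] by (metis le_imp_less_Suc)
  then obtain p where p: "path p" and max: "\<And>q. path q \<Longrightarrow> length q \<le> length p"
    by blast
  obtain p0 ps where p_eq: "p = p0 # ps" using p by (auto simp: path_def neq_Nil_conv)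
  have nbr_in_path: "w \<in> set p" if "(p0, w) \<in> R" for w
  proof (rule ccontr)
    assume "w \<notin> set p"
    moreover have "(w, p0) \<in> R" using that \<open>sym R\<close> by (meson symD)
    ultimately have "path (w # p)"
      using p \<open>R \<subseteq> V \<times> V\<close> by (auto simp: path_def p_eq nth_Cons split: nat.split)
    then show False using max by force
  qed
  have "p0 \<in> V" using p by (simp add: path_def p_eq)
  \<comment> \<open>Only the size of the singleton matters here, so the argument is valid even if
    \<open>p\<close> has no second vertex and \<open>p ! 1\<close> is unspecified.\<close>
  have "\<not> R `` {p0} \<subseteq> {p ! 1}"
  proof
    assume "R `` {p0} \<subseteq> {p ! 1}"
    then have "card (R `` {p0}) \<le> 1" using card_mono[of "{p ! 1}"] by simp
    then show False using deg[OF \<open>p0 \<in> V\<close>] by simp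
  qed
  then obtain w where w: "(p0, w) \<in> R" "w \<noteq> p ! 1" by blast
  then obtain j where j: "j < length p" "p ! j = w"
    using nbr_in_path by (metis in_set_conv_nth)
  have "w \<noteq> p0" using w \<open>irrefl R\<close> by (auto simp: irrefl_def)
  \<comment> \<open>Hence \<open>j\<close> is at least 2, and the prefix of \<open>p\<close> ending
    in \<open>w\<close> has at least 3 vertices; the arc from \<open>w\<close> to \<open>p0\<close>
    closes it.\<close>
  then have "j \<noteq> 0" "j \<noteq> 1" using j w p_eq by (metis nth_Cons_0)+
  have "cycle_in R (take (Suc j) p)"
    unfolding cycle_in_def
  proof (intro conjI allI impI)
    show "distinct (take (Suc j) p)" using p by (simp add: path_def)
    show "3 \<le> length (take (Suc j) p)" using j \<open>j \<noteq> 0\<close> \<open>j \<noteq> 1\<close> by simp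
    fix i assume i: "i < length (take (Suc j) p)"
    show "(take (Suc j) p ! i, take (Suc j) p ! (Suc i mod length (take (Suc j) p))) \<in> R"
    proof (cases "i = j")
      case True
      have "(w, p0) \<in> R" using w \<open>sym R\<close> by (meson symD)
      then show ?thesis using True j p_eq by (simp add: min_absorb2 del: take_Suc_Cons)
    next
      case False
      then show ?thesis using i j p by (simp add: path_def min_absorb2)
    qed
  qed
  moreover have "set (take (Suc j) p) \<subseteq> V" using p set_take_subset[of "Suc j" p]
    by (auto simp: path_def)
  ultimately show thesis using that by blast
qed

text \<open>This allows the starting vertex of a cycle to be changed, so that an alternating
  labelling can be made to start with 1.\<close>

lemma cycle_in_rotate1:
  assumes "cycle_in R vs"
  shows "cycle_in R (rotate1 vs)"
  unfolding cycle_in_def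
proof (intro conjI allI impI)
  show "distinct (rotate1 vs)" "3 \<le> length (rotate1 vs)"
    using assms by (simp_all add: cycle_in_def)
  fix i assume "i < length (rotate1 vs)"
  moreover from this have "Suc i mod length vs < length vs" by (auto intro: mod_less_divisor)
  ultimately show "(rotate1 vs ! i, rotate1 vs ! (Suc i mod length (rotate1 vs))) \<in> R"
    using assms by (simp add: cycle_in_def nth_rotate1)
qed

lemma parcs_cycle_graph_subset:
  assumes "cycle_in R vs" "sym R"
  shows "parcs (cycle_graph vs) \<subseteq> R"
  using assms by (auto simp: cycle_graph_def cycle_in_def dest: symD)

lemma sym_parcs_cycle_graph: "sym (parcs (cycle_graph vs))"
  by (auto simp: cycle_graph_def sym_def)

lemma parcs_cycle_graph_in_verts: "parcs (cycle_graph vs) \<subseteq> set vs \<times> set vs"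
proof (cases "vs = []")
  case False
  then have "Suc i mod length vs < length vs" for i by simp
  then show ?thesis by (auto simp: cycle_graph_def)
qed (simp add: cycle_graph_def)

text \<open>The neighbours are the cyclic successor and the cyclic predecessor.\<close>

lemma card_cycle_graph_neighbours:
  assumes "distinct vs" "3 \<le> length vs" "v \<in> set vs"
  shows "card (parcs (cycle_graph vs) `` {v}) = 2"
proof -
  let ?n = "length vs"
  obtain i where i: "i < ?n" "v = vs ! i" using assms(3) by (metis in_set_conv_nth)
  \<comment> \<open>The position of the cyclic predecessor; position 0 wraps around to the last
    one.\<close>
  define h where "h = (if i = 0 then ?n - 1 else i - 1)"
  have h: "h < ?n" "Suc h mod ?n = i" using i assms(2) by (auto simp: h_def)
  have h_unique: "k = h" if "k < ?n" "Suc k mod ?n = i" for k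
    using that i assms(2) by (auto simp: h_def mod_Suc split: if_splits)
  \<comment> \<open>Successor and predecessor differ because there are at least 3 positions; in a
    list of length 2 they would coincide.\<close>
  have s: "Suc i mod ?n < ?n" "Suc i mod ?n \<noteq> h"
    using i assms(2) by (auto simp: h_def mod_Suc split: if_splits)
  have "parcs (cycle_graph vs) `` {v} = {vs ! (Suc i mod ?n), vs ! h}" (is "?N = _")
  proof
    show "{vs ! (Suc i mod ?n), vs ! h} \<subseteq> ?N"
      using i h by (force simp: cycle_graph_def)
    show "?N \<subseteq> {vs ! (Suc i mod ?n), vs ! h}"
    proof
      fix w assume "w \<in> ?N"
      then obtain k where k: "k < ?n"
        "vs ! k = v \<and> w = vs ! (Suc k mod ?n) \<or> w = vs ! k \<and> vs ! (Suc k mod ?n) = v"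
        by (auto simp: cycle_graph_def)
      moreover have "Suc k mod ?n < ?n" using k(1) by (intro mod_less_divisor) linarith
      ultimately have "k = i \<and> w = vs ! (Suc k mod ?n) \<or> w = vs ! k \<and> Suc k mod ?n = i"
        using i assms(1) by (metis nth_eq_iff_index_eq)
      then show "w \<in> {vs ! (Suc i mod ?n), vs ! h}"
        using h_unique k(1) by blast
    qed
  qed
  then show ?thesis using s h assms(1) by (simp add: nth_eq_iff_index_eq)
qed

text \<open>The two neighbours on the cycle exhaust those in \<open>R\<close>, so no arc of
  \<open>R\<close> leaves the cycle: it is a whole component.\<close>

lemma parcs_cycle_graph_eq:
  assumes "cycle_in R vs" "sym R" and deg: "\<And>v. v \<in> set vs \<Longrightarrow> card (R `` {v}) = 2"
  shows "parcs (cycle_graph vs) = R \<inter> (set vs \<times> UNIV)"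
proof
  show "parcs (cycle_graph vs) \<subseteq> R \<inter> (set vs \<times> UNIV)"
    using parcs_cycle_graph_subset[OF assms(1,2)] parcs_cycle_graph_in_verts[of vs] by auto
  have "parcs (cycle_graph vs) `` {v} = R `` {v}" if "v \<in> set vs" for v
  proof (rule card_subset_eq)
    \<comment> \<open>Infinite sets have \<open>card\<close> 0, so cardinality 2 implies
      finiteness.\<close>
    show "finite (R `` {v})" using deg[OF that] card.infinite by fastforce
    show "parcs (cycle_graph vs) `` {v} \<subseteq> R `` {v}"
      using parcs_cycle_graph_subset[OF assms(1,2)] by blast
    show "card (parcs (cycle_graph vs) `` {v}) = card (R `` {v})"
      using that assms(1) deg card_cycle_graph_neighbours[of vs v] by (simp add: cycle_in_def)
  qed
  then show "R \<inter> (set vs \<times> UNIV) \<subseteq> parcs (cycle_graph vs)" by blast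
qed

text \<open>These facts let \<open>unlike_regular_add_links\<close> treat even cycles with
  \<open>k = 2\<close>, and let a graph be decomposed into such cycles without going back to vertex
  lists.\<close>

lemma even_cycle_carrying_props:
  assumes "even_cycle_carrying C x"
  shows "parcs C \<subseteq> pverts C \<times> pverts C" "sym (parcs C)" "pverts C \<noteq> {}"
    and "v \<in> pverts C \<Longrightarrow> x v = 1 \<or> x v = -1"
    and "v \<in> pverts C \<Longrightarrow> card (parcs C `` {v}) = 2"
    and "(u, v) \<in> parcs C \<Longrightarrow> x u \<noteq> x v"
proof -
  obtain vs where vs: "distinct vs" "3 \<le> length vs" "even (length vs)" "C = cycle_graph vs"
    and x: "\<And>i. i < length vs \<Longrightarrow> x (vs ! i) = (-1) ^ i"
    using assms by (auto simp: even_cycle_carrying_def)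
  have V: "pverts C = set vs" by (simp add: vs cycle_graph_def)
  show "parcs C \<subseteq> pverts C \<times> pverts C" "sym (parcs C)"
    unfolding V by (simp_all add: vs(4) parcs_cycle_graph_in_verts sym_parcs_cycle_graph)
  show "pverts C \<noteq> {}" using vs(2) V by auto
  show "x v = 1 \<or> x v = -1" if "v \<in> pverts C"
    using that x by (metis V in_set_conv_nth neg_one_even_power neg_one_odd_power)
  show "card (parcs C `` {v}) = 2" if "v \<in> pverts C"
    using that vs V card_cycle_graph_neighbours by metis
  show "x u \<noteq> x v" if "(u, v) \<in> parcs C"
  proof -
    have "x (vs ! i) \<noteq> x (vs ! (Suc i mod length vs))" if "i < length vs" for i
    proof -
      \<comment> \<open>Reduction modulo an even length preserves parity, so the closing edge also
        joins different values.\<close>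
      have "even (Suc i mod length vs) = even (Suc i)" using vs(3) by (simp add: dvd_mod_iff)
      moreover have "Suc i mod length vs < length vs" using that by (intro mod_less_divisor) linarith
      ultimately show ?thesis using x that by (cases "even i") simp_all
    qed
    then show ?thesis using that by (auto simp: vs(4) cycle_graph_def; metis)
  qed
qed

text \<open>Each arc of \<open>R\<close> flips the sign, and going once around a cycle must restore
  it, so the length is even. By 2-regularity the cycle found is a component of \<open>R\<close>, so
  the search can be repeated on the remaining vertices.\<close>

lemma even_cycle_carrying_exists:
  fixes x :: "'a \<Rightarrow> real"
  assumes "finite V" "V \<noteq> {}" "R \<subseteq> V \<times> V" "sym R"
    and deg: "\<And>v. v \<in> V \<Longrightarrow> card (R `` {v}) = 2"
    and val: "\<And>v. v \<in> V \<Longrightarrow> x v = 1 \<or> x v = -1"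
    and unlike: "\<And>u v. (u, v) \<in> R \<Longrightarrow> x u \<noteq> x v"
  obtains C where "even_cycle_carrying C x" "pverts C \<subseteq> V" "parcs C = R \<inter> (pverts C \<times> UNIV)"
proof -
  have "irrefl R" using unlike by (auto simp: irrefl_def)
  obtain ws where ws: "cycle_in R ws" "set ws \<subseteq> V"
    using cycle_in_exists[of V R] assms(1-4) \<open>irrefl R\<close> deg by (metis order_refl)
  have neg: "x v = - x u" if "(u, v) \<in> R" for u v
  proof -
    have "u \<in> V" "v \<in> V" using that assms(3) by auto
    then show ?thesis using val[of u] val[of v] unlike[OF that] by auto
  qed
  \<comment> \<open>The alternating vector starts with the value 1, so the cycle may have to be rotated.\<close>
  have "\<exists>vs. cycle_in R vs \<and> set vs = set ws \<and> x (vs ! 0) = 1"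
  proof (cases "x (ws ! 0) = 1")
    case False
    have l: "3 \<le> length ws" using ws by (simp add: cycle_in_def)
    then have "ws ! 0 \<in> V" "(ws ! 0, ws ! 1) \<in> R"
      using ws assms(3) by (force simp: cycle_in_def dest!: spec[of _ 0])+
    then have "x (ws ! 1) = 1" using False val[of "ws ! 0"] neg by fastforce
    then have "x (rotate1 ws ! 0) = 1" using l by (cases ws) (auto simp: nth_append)
    then show ?thesis using cycle_in_rotate1[OF ws(1)] by (metis set_rotate1)
  qed (use ws in auto)
  then obtain vs where vs: "cycle_in R vs" "set vs = set ws" "x (vs ! 0) = 1" by blast
  then have "distinct vs" and len: "3 \<le> length vs"
    and step: "\<And>i. i < length vs \<Longrightarrow> x (vs ! (Suc i mod length vs)) = - x (vs ! i)"
    using neg by (auto simp: cycle_in_def)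
  have alt: "x (vs ! i) = (-1) ^ i" if "i < length vs" for i
    using that
  proof (induction i)
    case (Suc i)
    then show ?case using step[of i] by simp
  qed (simp add: vs)
  have "even (length vs)"
  proof (rule ccontr)
    assume "odd (length vs)"
    then have "even (length vs - 1)" by simp
    then have "x (vs ! (length vs - 1)) = 1" using alt[of "length vs - 1"] len by simp
    moreover have "x (vs ! 0) = - x (vs ! (length vs - 1))"
      using step[of "length vs - 1"] len by (cases "length vs") auto
    ultimately show False using vs(3) by simp
  qed
  have "pverts (cycle_graph vs) = set vs" by (simp add: cycle_graph_def)
  moreover have "parcs (cycle_graph vs) = R \<inter> (set vs \<times> UNIV)"
    using parcs_cycle_graph_eq[OF vs(1) \<open>sym R\<close>] deg vs(2) ws(2) by blast
  moreover have "even_cycle_carrying (cycle_graph vs) x"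
    unfolding even_cycle_carrying_def using \<open>distinct vs\<close> len \<open>even (length vs)\<close> alt by blast
  ultimately show thesis using that vs(2) ws(2) by metis
qed

subsection \<open>Counting unlike arcs\<close>

text \<open>A walk from a vertex in \<open>S\<close> to a vertex outside must contain an arc that
  leaves \<open>S\<close>.\<close>

lemma connected_imp_arc_leaving:
  assumes "Digraph_Component.connected (with_proj G)" "sym (parcs G)"
    and "S \<subseteq> pverts G" "S \<noteq> {}" "S \<noteq> pverts G"
  obtains u v where "(u, v) \<in> parcs G" "u \<in> S" "v \<notin> S"
proof -
  obtain a b where ab: "a \<in> S" "b \<in> pverts G" "b \<notin> S" using assms by blast
  \<comment> \<open>Connectedness is expressed through the symmetric closure, which adds nothing to
    a symmetric set of arcs.\<close>
  have "symcl (parcs G) = parcs G" using assms(2) by (auto simp: symcl_def dest: symD)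
  then have "(a, b) \<in> rtrancl_on (pverts G) (parcs G)"
    using assms ab by (auto simp: connected_conv)
  then have "(a, b) \<in> (parcs G)\<^sup>*" by (rule rtrancl_on_rtranclI)
  then have "\<exists>u v. (u, v) \<in> parcs G \<and> u \<in> S \<and> v \<notin> S" using ab(1,3)
    by (induction rule: rtrancl_induct) blast+
  then show thesis using that by blast
qed

text \<open>Each unordered pair comes from exactly two arcs: symmetry provides both directions, and
  irreflexivity makes them different.\<close>

lemma card_sym_irrefl_eq:
  assumes "finite A" "sym A" "irrefl A"
  shows "card A = 2 * card {{u, v} | u v. (u, v) \<in> A}"
proof -
  let ?f = "\<lambda>(u, v). {u, v}"
  have img: "{{u, v} | u v. (u, v) \<in> A} = ?f ` A" by auto
  have "card {a \<in> A. ?f a = e} = 2" if e: "e \<in> ?f ` A" for e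
  proof -
    obtain u v where uv: "(u, v) \<in> A" "e = {u, v}" using e by auto
    then have "(v, u) \<in> A" "u \<noteq> v" using assms(2,3) by (auto simp: irrefl_def dest: symD)
    then have "{a \<in> A. ?f a = e} = {(u, v), (v, u)}" using uv by (auto simp: doubleton_eq_iff)
    then show ?thesis using \<open>u \<noteq> v\<close> by simp
  qed
  then have "(\<Sum>e\<in>?f ` A. card {a \<in> A. ?f a = e}) = (\<Sum>e\<in>?f ` A. 2)"
    by (intro sum.cong refl)
  moreover have "card A = (\<Sum>e\<in>?f ` A. card {a \<in> A. ?f a = e})"
    using sum.image_gen[OF assms(1), of "\<lambda>_. 1::nat" ?f] unfolding card_eq_sum .
  ultimately show ?thesis unfolding img by (simp only: sum_constant) (simp only: mult.commute of_nat_id)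
qed

definition unlike_arcs :: "'a pair_pre_digraph \<Rightarrow> ('a \<Rightarrow> real) \<Rightarrow> 'a rel" where
  "unlike_arcs G x = {(u, v) \<in> parcs G. x u \<noteq> x v}"

definition unlike_regular :: "'a pair_pre_digraph \<Rightarrow> ('a \<Rightarrow> real) \<Rightarrow> nat \<Rightarrow> bool" where
  "unlike_regular G x k \<longleftrightarrow>
     (\<forall>v\<in>pverts G. (x v = 1 \<or> x v = -1) \<and> card (unlike_arcs G x `` {v}) = k)"

text \<open>This permits replacing an arbitrary labelling by a vector that agrees with it on the
  vertices only.\<close>

lemma unlike_regular_cong:
  assumes "pair_graph G" "\<And>v. v \<in> pverts G \<Longrightarrow> x v = y v"
  shows "unlike_regular G x k \<longleftrightarrow> unlike_regular G y k"
proof -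
  interpret pair_graph G by fact
  have "unlike_arcs G x = unlike_arcs G y"
    unfolding unlike_arcs_def by (auto simp: assms(2) wellformed')
  then show ?thesis using assms(2) by (simp add: unlike_regular_def)
qed

lemma pair_graph_parcs:
  assumes "pair_graph G"
  shows "finite (pverts G)" "finite (parcs G)" "sym (parcs G)" "irrefl (parcs G)"
    "parcs G \<subseteq> pverts G \<times> pverts G"
proof -
  interpret pair_graph G by fact
  show "finite (pverts G)" "finite (parcs G)" by (fact pair_finite_verts pair_finite_arcs)+
  show "sym (parcs G)" by (auto simp: sym_def arcs_symmetric)
  show "irrefl (parcs G)" by (auto simp: irrefl_def dest: no_loops')
  show "parcs G \<subseteq> pverts G \<times> pverts G" by (auto dest: wellformed')
qed

lemma unlike_arcs_pair_graph:
  assumes "pair_graph G"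
  shows "finite (unlike_arcs G x)" "sym (unlike_arcs G x)"
    "unlike_arcs G x \<subseteq> pverts G \<times> pverts G" "unlike_arcs G x \<subseteq> parcs G"
proof -
  show sub: "unlike_arcs G x \<subseteq> parcs G" by (auto simp: unlike_arcs_def)
  then show "finite (unlike_arcs G x)" "unlike_arcs G x \<subseteq> pverts G \<times> pverts G"
    using pair_graph_parcs[OF assms] by (auto intro: finite_subset)
  show "sym (unlike_arcs G x)"
    using pair_graph_parcs(3)[OF assms] by (auto simp: unlike_arcs_def sym_def)
qed

text \<open>A single unlike arc suffices: its ends have different values, and only \<plusminus>1 are
  available.\<close>

lemma unlike_regular_values:
  assumes "pair_graph G" "pverts G \<noteq> {}" "unlike_regular G x k" "0 < k"
  shows "x ` pverts G = {-1, 1}"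
proof -
  obtain v where v: "v \<in> pverts G" using assms(2) by blast
  then have "card (unlike_arcs G x `` {v}) \<noteq> 0" using assms(3,4) by (simp add: unlike_regular_def)
  then have "unlike_arcs G x `` {v} \<noteq> {}" by (metis card.empty)
  then obtain w where "(v, w) \<in> unlike_arcs G x" by blast
  then have "w \<in> pverts G" "x v \<noteq> x w"
    using unlike_arcs_pair_graph(3)[OF assms(1)] by (auto simp: unlike_arcs_def)
  moreover have val: "x u = 1 \<or> x u = -1" if "u \<in> pverts G" for u
    using that assms(3) by (simp add: unlike_regular_def)
  ultimately have "{x v, x w} = {-1, 1}" using v val[of v] val[of w] by fastforce
  then have "{-1, 1} \<subseteq> x ` pverts G" using v \<open>w \<in> pverts G\<close> by blast
  then show ?thesis using val by blast
qed

text \<open>The arcs are counted by their tails.\<close>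

lemma card_unlike_arcs:
  assumes "pair_graph G" "unlike_regular G x k"
  shows "card (unlike_arcs G x) = card (pverts G) * k"
proof -
  let ?R = "unlike_arcs G x"
  have "?R = (SIGMA v:pverts G. ?R `` {v})" using unlike_arcs_pair_graph(3)[OF assms(1), of x] by auto
  then have "card ?R = card (SIGMA v:pverts G. ?R `` {v})" by simp
  also have "\<dots> = (\<Sum>v\<in>pverts G. card (?R `` {v}))"
    using pair_graph_parcs(1)[OF assms(1)] unlike_arcs_pair_graph(1)[OF assms(1), of x]
    by (intro card_SigmaI) auto
  also have "\<dots> = (\<Sum>v\<in>pverts G. k)" using assms(2) by (intro sum.cong) (auto simp: unlike_regular_def)
  finally show ?thesis by simp
qed

lemma card_parcs_bicyclic:
  assumes "bicyclic G"
  shows "card (parcs G) = 2 * (card (pverts G) + 1)"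
  using assms card_sym_irrefl_eq[of "parcs G"] pair_graph_parcs[of G]
  by (simp add: bicyclic_def undirected_edges_def)

lemma unlike_regular_degree:
  assumes "bicyclic G" "unlike_regular G x k" "x ` pverts G = {-1, 1}"
  shows "k = 1 \<or> k = 2"
proof -
  let ?n = "card (pverts G)"
  have G: "pair_graph G" using assms(1) by (simp add: bicyclic_def)
  note fin = pair_graph_parcs(1,2)[OF G]
  have "card (unlike_arcs G x) \<le> card (parcs G)"
    using fin unlike_arcs_pair_graph(4)[OF G] by (intro card_mono)
  then have nk: "?n * k \<le> 2 * (?n + 1)"
    using card_unlike_arcs[OF G assms(2)] card_parcs_bicyclic[OF assms(1)] by simp
  have "-1 \<in> x ` pverts G" "1 \<in> x ` pverts G" using assms(3) by auto
  then obtain v w where vw: "v \<in> pverts G" "x v = -1" "w \<in> pverts G" "x w = 1" by force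
  have "unlike_arcs G x `` {v} \<subseteq> pverts G - {v}"
    using unlike_arcs_pair_graph(3)[OF G, of x] by (auto simp: unlike_arcs_def)
  then have "k \<le> card (pverts G - {v})"
    using fin assms(2) vw(1) card_mono[of "pverts G - {v}"] by (fastforce simp: unlike_regular_def)
  then have kn: "k < ?n" using fin vw(1) by (metis card_Diff1_less order_le_less_trans)
  have "k \<noteq> 0"
  proof
    assume "k = 0"
    \<comment> \<open>Both values occur, so this set is nonempty and proper; by connectedness an arc
      leaves it, and such an arc is unlike.\<close>
    let ?S = "{u \<in> pverts G. x u = -1}"
    have "?S \<subseteq> pverts G" "?S \<noteq> {}" "?S \<noteq> pverts G" using vw by force+
    then obtain a b where ab: "(a, b) \<in> parcs G" "a \<in> ?S" "b \<notin> ?S"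
      using connected_imp_arc_leaving[of G ?S] assms(1) pair_graph_parcs(3)[OF G]
      by (auto simp: bicyclic_def)
    then have "(a, b) \<in> unlike_arcs G x"
      using pair_graph_parcs(5)[OF G] by (auto simp: unlike_arcs_def)
    moreover have "card (unlike_arcs G x `` {a}) = 0"
      using \<open>k = 0\<close> ab(2) assms(2) by (simp add: unlike_regular_def)
    ultimately show False using unlike_arcs_pair_graph(1)[OF G, of x] by auto
  qed
  moreover have "\<not> 3 \<le> k"
  proof
    assume "3 \<le> k"
    \<comment> \<open>With the bound \<open>nk\<close> this gives \<open>?n \<le> 2\<close>, whereas
      \<open>kn\<close> gives \<open>3 \<le> k < ?n\<close>.\<close>
    then have "?n * 3 \<le> ?n * k" by simp
    then have "?n * 3 \<le> 2 * (?n + 1)" using nk by (rule order_trans)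
    then show False using kn \<open>3 \<le> k\<close> by simp
  qed
  ultimately show ?thesis by linarith
qed

subsection \<open>Labelled graphs connected by equal links\<close>

text \<open>Equal links create no unlike arcs, and by disjointness a vertex lies in only one member
  of \<open>\<H>\<close>, so its unlike neighbours are exactly its neighbours there. This serves the
  chains with \<open>k = 1\<close> and the even cycles with \<open>k = 2\<close>.\<close>

lemma unlike_regular_add_links:
  assumes "disjoint_family_on pverts \<H>"
    and parcs: "\<And>H. H \<in> \<H> \<Longrightarrow> parcs H \<subseteq> pverts H \<times> pverts H"
    and unlike: "\<And>H u v. H \<in> \<H> \<Longrightarrow> (u, v) \<in> parcs H \<Longrightarrow> x u \<noteq> x v"
    and val: "\<And>H v. H \<in> \<H> \<Longrightarrow> v \<in> pverts H \<Longrightarrow> x v = 1 \<or> x v = -1"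
    and deg: "\<And>H v. H \<in> \<H> \<Longrightarrow> v \<in> pverts H \<Longrightarrow> card (parcs H `` {v}) = k"
    and links: "\<And>u v. {u, v} \<in> F \<Longrightarrow> x u = x v"
  shows "unlike_regular (add_links \<H> F) x k"
  unfolding unlike_regular_def
proof
  let ?G = "add_links \<H> F"
  fix v assume "v \<in> pverts ?G"
  then obtain H where H: "H \<in> \<H>" "v \<in> pverts H" by (auto simp: add_links_def)
  have "unlike_arcs ?G x `` {v} = parcs H `` {v}"
  proof
    show "parcs H `` {v} \<subseteq> unlike_arcs ?G x `` {v}"
      using H unlike by (auto simp: unlike_arcs_def add_links_def)
    show "unlike_arcs ?G x `` {v} \<subseteq> parcs H `` {v}"
    proof
      fix w assume "w \<in> unlike_arcs ?G x `` {v}"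
      then obtain H' where H': "H' \<in> \<H>" "(v, w) \<in> parcs H'"
        using links by (auto simp: unlike_arcs_def add_links_def)
      then have "v \<in> pverts H'" using parcs by blast
      then have "H' = H" using H H'(1) assms(1) by (auto simp: disjoint_family_on_def)
      then show "w \<in> parcs H `` {v}" using H'(2) by simp
    qed
  qed
  then show "(x v = 1 \<or> x v = -1) \<and> card (unlike_arcs ?G x `` {v}) = k"
    using H val deg by simp
qed

text \<open>For \<open>k = 1\<close> the unlike edges are a perfect matching: the matched pairs are
  the chains, and all other edges are equal links.\<close>

lemma P2s_connected_by_equal_links_iff:
  assumes "pair_graph G"
  shows "P2s_connected_by_equal_links G x \<longleftrightarrow> unlike_regular G x 1"
proof
  assume "P2s_connected_by_equal_links G x"
  then obtain \<H> F where "disjoint_family_on pverts \<H>" and P2: "\<And>H. H \<in> \<H> \<Longrightarrow> P2_carrying H x"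
    and F: "\<And>e. e \<in> F \<Longrightarrow> \<exists>u v. e = {u, v} \<and> x u = x v" and G: "G = add_links \<H> F"
    unfolding P2s_connected_by_equal_links_def by (metis (no_types))
  then show "unlike_regular G x 1"
    unfolding G
  proof (intro unlike_regular_add_links)
    fix H assume "H \<in> \<H>"
    then obtain a b where H: "a \<noteq> b" "H = \<lparr>pverts = {a, b}, parcs = {(a, b), (b, a)}\<rparr>"
      "x a = 1" "x b = -1"
      using P2 unfolding P2_carrying_def by blast
    show "parcs H \<subseteq> pverts H \<times> pverts H" by (auto simp: H)
    show "x u \<noteq> x v" if "(u, v) \<in> parcs H" for u v using that H by auto
    show "x v = 1 \<or> x v = -1" if "v \<in> pverts H" for v using that H by auto
    show "card (parcs H `` {v}) = 1" if "v \<in> pverts H" for v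
    proof -
      have "parcs H `` {v} = {if v = a then b else a}" using that H by auto
      then show ?thesis by simp
    qed
  next
    fix u v assume "{u, v} \<in> F"
    then show "x u = x v" using F[of "{u, v}"] by (auto simp: doubleton_eq_iff)
  qed
next
  assume reg: "unlike_regular G x 1"
  let ?R = "unlike_arcs G x"
  note R = unlike_arcs_pair_graph[OF assms, of x] and parcs = pair_graph_parcs[OF assms]
  define chain where "chain u v = \<lparr>pverts = {u, v}, parcs = {(u, v), (v, u)}\<rparr>" for u v :: 'a
  \<comment> \<open>Each matched edge is read from its end of value 1, the orientation that
    \<open>P2_carrying\<close> expects.\<close>
  define \<H> where "\<H> = {chain u v | u v. (u, v) \<in> ?R \<and> x u = 1}"
  define F where "F = {{u, v} | u v. (u, v) \<in> parcs G \<and> x u = x v}"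
  have unique: "v = w" if "(u, v) \<in> ?R" "(u, w) \<in> ?R" for u v w
  proof -
    have "card (?R `` {u}) = 1" using reg R(3) that(1) by (auto simp: unlike_regular_def)
    then obtain z where "?R `` {u} = {z}" by (auto simp: card_1_singleton_iff)
    then have "v \<in> {z}" "w \<in> {z}" using that by blast+
    then show ?thesis by simp
  qed
  have val: "x u = 1 \<and> x v = -1 \<or> x u = -1 \<and> x v = 1" if "(u, v) \<in> ?R" for u v
  proof -
    have "u \<in> pverts G" "v \<in> pverts G" using that R(3) by auto
    then have "x u = 1 \<or> x u = -1" "x v = 1 \<or> x v = -1" using reg by (auto simp: unlike_regular_def)
    then show ?thesis using that by (auto simp: unlike_arcs_def)
  qed
  have "disjoint_family_on pverts \<H>"
    unfolding disjoint_family_on_def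
  proof (intro ballI impI, rule ccontr)
    fix H H' assume "H \<in> \<H>" "H' \<in> \<H>" "H \<noteq> H'" "pverts H \<inter> pverts H' \<noteq> {}"
    then obtain u v u' v' where uv: "(u, v) \<in> ?R" "x u = 1" "H = chain u v"
      and uv': "(u', v') \<in> ?R" "x u' = 1" "H' = chain u' v'"
      by (auto simp: \<H>_def)
    then have "x v = -1" "x v' = -1" using val[of u v] val[of u' v'] by auto
    \<comment> \<open>A common vertex has one value, so it is the positive end of both chains or the
      negative end of both; uniqueness of the partner then identifies the chains.\<close>
    then have "u = u' \<or> v = v'"
      using \<open>pverts H \<inter> pverts H' \<noteq> {}\<close> uv uv' by (auto simp: chain_def)
    moreover have "(v, u) \<in> ?R" "(v', u') \<in> ?R" using uv uv' R(2) by (auto dest: symD)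
    ultimately have "u = u' \<and> v = v'" using unique uv(1) uv'(1) by blast
    then show False using uv uv' \<open>H \<noteq> H'\<close> by simp
  qed
  moreover have "P2_carrying H x" if "H \<in> \<H>" for H
  proof -
    obtain u v where "(u, v) \<in> ?R" "x u = 1" "H = chain u v" using \<open>H \<in> \<H>\<close> by (auto simp: \<H>_def)
    moreover from this have "x v = -1" using val[of u v] by auto
    ultimately show ?thesis unfolding P2_carrying_def chain_def by force
  qed
  moreover have verts: "(\<Union>H\<in>\<H>. pverts H) = pverts G"
  proof
    show "(\<Union>H\<in>\<H>. pverts H) \<subseteq> pverts G" using R(3) by (auto simp: \<H>_def chain_def)
    show "pverts G \<subseteq> (\<Union>H\<in>\<H>. pverts H)"
    proof
      fix v assume "v \<in> pverts G"
      then have "card (?R `` {v}) = 1" using reg by (simp add: unlike_regular_def)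
      then have "?R `` {v} \<noteq> {}" by force
      then obtain w where w: "(v, w) \<in> ?R" by blast
      then have "(w, v) \<in> ?R" using R(2) by (meson symD)
      then have "chain v w \<in> \<H> \<or> chain w v \<in> \<H>"
        using w val[OF w] by (auto simp: \<H>_def)
      then show "v \<in> (\<Union>H\<in>\<H>. pverts H)" by (force simp: chain_def)
    qed
  qed
  moreover have "\<forall>e\<in>F. \<exists>u\<in>\<Union>(pverts ` \<H>). \<exists>v\<in>\<Union>(pverts ` \<H>). e = {u, v} \<and> u \<noteq> v \<and> x u = x v"
    unfolding verts using parcs(4,5) by (fastforce simp: F_def irrefl_def)
  moreover have "G = add_links \<H> F"
  proof -
    have "(\<Union>H\<in>\<H>. parcs H) = ?R"
    proof
      show "(\<Union>H\<in>\<H>. parcs H) \<subseteq> ?R" using R(2) by (auto simp: \<H>_def chain_def dest: symD)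
      show "?R \<subseteq> (\<Union>H\<in>\<H>. parcs H)"
      proof clarify
        fix u v assume uv: "(u, v) \<in> ?R"
        then have "(v, u) \<in> ?R" using R(2) by (meson symD)
        then have "chain u v \<in> \<H> \<or> chain v u \<in> \<H>"
          using uv val[OF uv] by (auto simp: \<H>_def)
        then show "(u, v) \<in> (\<Union>H\<in>\<H>. parcs H)" by (force simp: chain_def)
      qed
    qed
    moreover have "{(u, v). {u, v} \<in> F} = parcs G - ?R"
      using parcs(3) by (auto simp: F_def unlike_arcs_def doubleton_eq_iff dest: symD)
    ultimately have "parcs G = (\<Union>H\<in>\<H>. parcs H) \<union> {(u, v). {u, v} \<in> F}" using R(4) by blast
    then show ?thesis using verts by (simp add: add_links_def)
  qed
  ultimately show "P2s_connected_by_equal_links G x"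
    unfolding P2s_connected_by_equal_links_def by blast
qed

text \<open>Both shapes are families of disjoint even cycles with one equal link added, so they can
  be handled together.\<close>

lemma even_cycles_imp_unlike_regular:
  assumes "even_cycle_with_equal_link G x \<or> two_even_cycles_connected_by_equal_link G x"
  shows "unlike_regular G x 2"
proof -
  obtain \<H> u v where "disjoint_family_on pverts \<H>" "\<And>H. H \<in> \<H> \<Longrightarrow> even_cycle_carrying H x"
    and uv: "x u = x v" "G = add_links \<H> {{u, v}}"
    using assms
  proof
    assume "even_cycle_with_equal_link G x"
    then obtain C u v where "even_cycle_carrying C x" "x u = x v" "G = add_links {C} {{u, v}}"
      unfolding even_cycle_with_equal_link_def by blast
    then show thesis using that[of "{C}" u v] by (simp add: disjoint_family_on_def)
  next
    assume "two_even_cycles_connected_by_equal_link G x"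
    then obtain C1 C2 u v where "even_cycle_carrying C1 x" "even_cycle_carrying C2 x"
      "pverts C1 \<inter> pverts C2 = {}" "x u = x v" "G = add_links {C1, C2} {{u, v}}"
      unfolding two_even_cycles_connected_by_equal_link_def by blast
    then show thesis using that[of "{C1, C2}" u v] by (auto simp: disjoint_family_on_def)
  qed
  then show ?thesis
    unfolding uv(2)
    by (intro unlike_regular_add_links)
      (auto dest: even_cycle_carrying_props simp: doubleton_eq_iff)
qed

text \<open>A first cycle \<open>C\<close> is split off. If it misses vertices, a second cycle
  \<open>D\<close> is found among them, and the single like edge must join the two, which leaves no
  way to reach a third.\<close>

lemma unlike_regular_imp_even_cycles:
  assumes "bicyclic G" "unlike_regular G x 2"
  shows "even_cycle_with_equal_link G x \<or> two_even_cycles_connected_by_equal_link G x"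
proof -
  let ?R = "unlike_arcs G x" and ?V = "pverts G"
  have G: "pair_graph G" and conn: "Digraph_Component.connected (with_proj G)"
    using assms(1) by (simp_all add: bicyclic_def)
  note R = unlike_arcs_pair_graph[OF G, of x] and parcs = pair_graph_parcs[OF G]
  have "?V \<noteq> {}" using conn by (simp add: connected_conv)
  have val: "v \<in> ?V \<Longrightarrow> x v = 1 \<or> x v = -1" and deg: "v \<in> ?V \<Longrightarrow> card (?R `` {v}) = 2" for v
    using assms(2) by (simp_all add: unlike_regular_def)
  have unlike: "x u \<noteq> x v" if "(u, v) \<in> ?R" for u v using that by (simp add: unlike_arcs_def)
  define L where "L = parcs G - ?R"
  \<comment> \<open>With \<open>n\<close> vertices there are \<open>2 * (n + 1)\<close> arcs in all
    and \<open>2 * n\<close> unlike ones; the two like arcs are opposite and form one edge.\<close>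
  have "card L = 2"
    using card_Diff_subset[OF R(1,4)] card_unlike_arcs[OF G assms(2)] card_parcs_bicyclic[OF assms(1)]
    by (simp add: L_def)
  then have "L \<noteq> {}" by force
  then obtain a b where ab: "(a, b) \<in> L" by fastforce
  then have "(b, a) \<in> L" "a \<noteq> b" "x a = x b"
    using parcs(3,4) by (auto simp: L_def unlike_arcs_def irrefl_def dest: symD)
  then have "{(a, b), (b, a)} = L"
    using ab \<open>card L = 2\<close> card.infinite by (intro card_subset_eq) fastforce+
  then have G_parcs: "parcs G = ?R \<union> {(u, v). {u, v} = {a, b}}"
    using R(4) by (auto simp: L_def doubleton_eq_iff)
  obtain C where C: "even_cycle_carrying C x" "pverts C \<subseteq> ?V" "parcs C = ?R \<inter> (pverts C \<times> UNIV)"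
    using even_cycle_carrying_exists[OF parcs(1) \<open>?V \<noteq> {}\<close> R(3,2), of x] deg val unlike by blast
  let ?S = "pverts C"
  note C_props = even_cycle_carrying_props[OF C(1)]
  have C_closed: "v \<in> ?S" if "(u, v) \<in> ?R" "u \<in> ?S" for u v
    using that C(3) C_props(1) by blast
  show ?thesis
  proof (cases "?S = ?V")
    case True
    then have "parcs C = ?R" using C(3) R(3) by blast
    then have "G = add_links {C} {{a, b}}" using True G_parcs by (simp add: add_links_def)
    moreover have "a \<in> ?S" "b \<in> ?S" "(a, b) \<notin> parcs C"
      using True ab parcs(5) \<open>parcs C = ?R\<close> by (auto simp: L_def)
    ultimately have "even_cycle_with_equal_link G x"
      unfolding even_cycle_with_equal_link_def using C(1) \<open>a \<noteq> b\<close> \<open>x a = x b\<close> by blast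
    then show ?thesis ..
  next
    case False
    obtain u v where uv: "(u, v) \<in> parcs G" "u \<in> ?S" "v \<notin> ?S"
      using connected_imp_arc_leaving[OF conn parcs(3) C(2) C_props(3) False] by blast
    \<comment> \<open>Unlike arcs stay inside \<open>C\<close>, so the arc leaving it is the like
      edge.\<close>
    then have uv_ab: "{u, v} = {a, b}" using C_closed G_parcs by blast
    \<comment> \<open>The unlike arcs starting outside \<open>C\<close>. By symmetry they also end
      outside, so 2-regularity is inherited.\<close>
    let ?R' = "?R \<inter> ((?V - ?S) \<times> UNIV)"
    have R'_closed: "w \<in> ?V - ?S" if "(u, w) \<in> ?R'" for u w
      using that C_closed R(2,3) by (auto dest: symD)
    have "finite (?V - ?S)" "?V - ?S \<noteq> {}" using parcs(1) False C(2) by auto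
    moreover have "?R' \<subseteq> (?V - ?S) \<times> (?V - ?S)" using R'_closed by blast
    moreover have "sym ?R'" using R'_closed R(2) by (auto intro!: symI dest: symD)
    moreover have "card (?R' `` {v}) = 2" if "v \<in> ?V - ?S" for v
    proof -
      have "?R' `` {v} = ?R `` {v}" using that by blast
      then show ?thesis using deg that by simp
    qed
    ultimately obtain D where D: "even_cycle_carrying D x" "pverts D \<subseteq> ?V - ?S"
      "parcs D = ?R' \<inter> (pverts D \<times> UNIV)"
      using even_cycle_carrying_exists[of "?V - ?S" ?R' x] val unlike by (metis DiffD1 IntD1)
    let ?T = "pverts D"
    note D_props = even_cycle_carrying_props[OF D(1)]
    have D_parcs: "parcs D = ?R \<inter> (?T \<times> UNIV)" using D(2,3) by blast
    have D_closed: "v \<in> ?T" if "(u, v) \<in> ?R" "u \<in> ?T" for u v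
      using that D_parcs D_props(1) by blast
    have "?T \<subseteq> ?V" "?T \<noteq> ?V" using D(2) C(2) C_props(3) by blast+
    then obtain u' v' where uv': "(u', v') \<in> parcs G" "u' \<in> ?T" "v' \<notin> ?T"
      using connected_imp_arc_leaving[OF conn parcs(3) _ D_props(3)] by blast
    \<comment> \<open>The arc leaving \<open>D\<close> is the like edge again; as its end
      \<open>u\<close> lies in \<open>C\<close>, the other end \<open>v\<close> lies in
      \<open>D\<close>.\<close>
    then have "{u', v'} = {u, v}" using D_closed G_parcs uv_ab by blast
    moreover have "u \<notin> ?T" using uv(2) D(2) by blast
    ultimately have "v \<in> ?T" using uv'(2) by (auto simp: doubleton_eq_iff)
    have "?S \<union> ?T = ?V"
    proof (rule ccontr)
      \<comment> \<open>An arc leaving the union would again have to be the like edge, but both ends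
        of that edge lie inside.\<close>
      assume "?S \<union> ?T \<noteq> ?V"
      then obtain p q where pq: "(p, q) \<in> parcs G" "p \<in> ?S \<union> ?T" "q \<notin> ?S \<union> ?T"
        using connected_imp_arc_leaving[OF conn parcs(3), of "?S \<union> ?T"] C(2) \<open>?T \<subseteq> ?V\<close> C_props(3)
        by blast
      then have "{p, q} = {u, v}" using C_closed D_closed G_parcs uv_ab by blast
      then have "q = u \<or> q = v" by (auto simp: doubleton_eq_iff)
      then show False using pq(3) uv(2) \<open>v \<in> ?T\<close> by blast
    qed
    then have "parcs C \<union> parcs D = ?R" using C(3) D_parcs R(3) by blast
    then have "G = add_links {C, D} {{u, v}}"
      using \<open>?S \<union> ?T = ?V\<close> G_parcs uv_ab by (simp add: add_links_def)
    moreover have "x u = x v" using uv_ab \<open>x a = x b\<close> by (auto simp: doubleton_eq_iff)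
    moreover have "?S \<inter> ?T = {}" using D(2) by blast
    ultimately have "two_even_cycles_connected_by_equal_link G x"
      unfolding two_even_cycles_connected_by_equal_link_def
      using C(1) D(1) uv(2) \<open>v \<in> ?T\<close> by blast
    then show ?thesis ..
  qed
qed

subsection \<open>Bivalent eigenvectors\<close>

text \<open>The diagonal entry is the number of neighbours of \<open>i\<close>, so it contributes
  one copy of \<open>x $ i\<close> for each of them.\<close>

lemma laplacian_mult_vec_index:
  assumes "pair_graph G" "pverts G = {0..<n}" "x \<in> carrier_vec n" "i < n"
  shows "(laplacian G *\<^sub>v x) $ i = (\<Sum>j\<in>parcs G `` {i}. x $ i - x $ j)"
proof -
  let ?N = "parcs G `` {i}"
  have sub: "?N \<subseteq> {0..<n}" using pair_graph_parcs(5)[OF assms(1)] assms(2) by auto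
  have irr: "(i, i) \<notin> parcs G" using pair_graph_parcs(4)[OF assms(1)] by (auto simp: irrefl_def)
  have "out_arcs (with_proj G) i = Pair i ` ?N" by (auto simp: out_arcs_def)
  then have deg: "out_degree (with_proj G) i = card ?N"
    by (simp add: out_degree_def card_image inj_on_def)
  have "(laplacian G *\<^sub>v x) $ i =
      (\<Sum>j\<in>{0..<n}. ((if i = j then real (card ?N) else 0) - (if j \<in> ?N then 1 else 0)) * x $ j)"
    using assms(2-4) deg
    by (auto simp: laplacian_def degree_matrix_def adjacency_matrix_def scalar_prod_def intro!: sum.cong)
  also have "\<dots> = (\<Sum>j\<in>{0..<n}. (if i = j then real (card ?N) * x $ j else 0))
      - (\<Sum>j\<in>{0..<n}. if j \<in> ?N then x $ j else 0)"
    unfolding sum_subtractf[symmetric] using irr by (intro sum.cong) (auto simp: left_diff_distrib)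
  also have "(\<Sum>j\<in>{0..<n}. (if i = j then real (card ?N) * x $ j else 0)) = real (card ?N) * x $ i"
    using assms(4) by (simp add: sum.delta)
  also have "(\<Sum>j\<in>{0..<n}. if j \<in> ?N then x $ j else 0) = (\<Sum>j\<in>?N. x $ j)"
    using sub by (simp add: sum.inter_restrict[symmetric] Int_absorb1 del: Image_singleton_iff)
  finally show ?thesis by (simp add: sum_subtractf)
qed

text \<open>For entries \<plusminus>1 the difference \<open>x $ i - x $ j\<close> is
  \<open>2 * x $ i\<close> at an unlike neighbour and 0 at a like one. Cancelling the nonzero
  \<open>x $ i\<close> in the eigenvalue equation leaves \<open>l\<close> as twice the number of
  unlike neighbours.\<close>

lemma bivalent_eigenvector_iff:
  assumes "pair_graph G" "pverts G = {0..<n}" "0 < n"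
  shows "bivalent_eigenvector G x l \<longleftrightarrow> x \<in> carrier_vec n \<and>
    (($) x) ` pverts G = {-1, 1} \<and> (\<exists>k. unlike_regular G (($) x) k \<and> l = 2 * real k)"
proof (cases "x \<in> carrier_vec n \<and> (($) x) ` pverts G = {-1, 1}")
  case True
  then have x: "x \<in> carrier_vec n" and val: "i < n \<Longrightarrow> x $ i = 1 \<or> x $ i = -1" for i
    using assms(2) by force+
  let ?d = "\<lambda>i. card (unlike_arcs G (($) x) `` {i})"
  have dim: "laplacian G \<in> carrier_mat n n"
    using assms(2) by (simp add: carrier_matI laplacian_def degree_matrix_def adjacency_matrix_def)
  have entry: "(laplacian G *\<^sub>v x) $ i = 2 * real (?d i) * x $ i" if "i < n" for i
  proof -
    have sub: "parcs G `` {i} \<subseteq> {0..<n}" using pair_graph_parcs(5)[OF assms(1)] assms(2) by auto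
    then have fin: "finite (parcs G `` {i})" by (rule finite_subset) simp
    have "(laplacian G *\<^sub>v x) $ i = (\<Sum>j\<in>parcs G `` {i}. x $ i - x $ j)"
      by (rule laplacian_mult_vec_index[OF assms(1,2) x that])
    also have "\<dots> = (\<Sum>j\<in>parcs G `` {i}. if x $ i \<noteq> x $ j then 2 * x $ i else 0)"
    proof (rule sum.cong)
      fix j assume "j \<in> parcs G `` {i}"
      then have "j < n" using sub by auto
      then show "x $ i - x $ j = (if x $ i \<noteq> x $ j then 2 * x $ i else 0)"
        using val[of i] val[of j] that by auto
    qed simp
    also have "\<dots> = real (card (parcs G `` {i} \<inter> {j. x $ i \<noteq> x $ j})) * (2 * x $ i)"
      using fin by (simp add: sum.If_cases)
    also have "parcs G `` {i} \<inter> {j. x $ i \<noteq> x $ j} = unlike_arcs G (($) x) `` {i}"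
      by (auto simp: unlike_arcs_def)
    finally show ?thesis by simp
  qed
  have "set\<^sub>v x = {-1, 1}" using True assms(2) by (auto simp: vec_set_def atLeast0LessThan)
  moreover have "x \<noteq> 0\<^sub>v n" using val[of 0] assms(3) by auto
  ultimately have "bivalent_eigenvector G x l \<longleftrightarrow> laplacian G *\<^sub>v x = l \<cdot>\<^sub>v x"
    using dim x by (simp add: bivalent_eigenvector_def eigenvector_def)
  also have "\<dots> \<longleftrightarrow> (\<forall>i<n. 2 * real (?d i) * x $ i = l * x $ i)"
    using dim x entry by (auto simp: vec_eq_iff)
  also have "\<dots> \<longleftrightarrow> (\<forall>i<n. l = 2 * real (?d i))"
    using val by (metis mult_cancel_right zero_neq_neg_one zero_neq_one)
  also have "\<dots> \<longleftrightarrow> (\<exists>k. unlike_regular G (($) x) k \<and> l = 2 * real k)"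
  proof
    assume l: "\<forall>i<n. l = 2 * real (?d i)"
    \<comment> \<open>Any vertex can supply the common degree; 0 is one because
      \<open>0 < n\<close>.\<close>
    define k where "k = ?d 0"
    have "?d i = k" if "i < n" for i
    proof -
      have "2 * real (?d i) = 2 * real k" unfolding k_def using l that assms(3) by metis
      then show ?thesis by linarith
    qed
    then have "unlike_regular G (($) x) k" using val assms(2) by (simp add: unlike_regular_def)
    moreover have "l = 2 * real k" unfolding k_def using l assms(3) by blast
    ultimately show "\<exists>k. unlike_regular G (($) x) k \<and> l = 2 * real k" by blast
  qed (use assms(2) in \<open>auto simp: unlike_regular_def\<close>)
  finally show ?thesis using True by blast
next
  case False
  have "dim_row (laplacian G) = n"
    using assms(2) by (simp add: laplacian_def degree_matrix_def adjacency_matrix_def)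
  then have "\<not> bivalent_eigenvector G x l"
    using False assms(2) by (auto simp: bivalent_eigenvector_def eigenvector_def vec_set_def atLeast0LessThan)
  then show ?thesis using False by blast
qed

theorem theorem4p2:
  fixes G :: "nat pair_pre_digraph" and n :: nat
  assumes "bicyclic G" and "pverts G = {0..<n}"
  shows "(bivalent G \<longleftrightarrow>
           (\<exists>x. P2s_connected_by_equal_links G x \<or>
                even_cycle_with_equal_link G x \<or>
                two_even_cycles_connected_by_equal_link G x)) \<and>
         (\<forall>x l. bivalent_eigenvector G x l \<longleftrightarrow>
           x \<in> carrier_vec n \<and>
           (P2s_connected_by_equal_links G (\<lambda>i. x $ i) \<and> l = 2 \<or>
            even_cycle_with_equal_link G (\<lambda>i. x $ i) \<and> l = 4 \<or>
            two_even_cycles_connected_by_equal_link G (\<lambda>i. x $ i) \<and> l = 4))"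
proof -
  have G: "pair_graph G" using assms(1) by (simp add: bicyclic_def)
  have "pverts G \<noteq> {}" using assms(1) by (simp add: bicyclic_def connected_conv)
  then have "0 < n" using assms(2) by simp
  have deg1: "P2s_connected_by_equal_links G x \<longleftrightarrow> unlike_regular G x 1" for x
    by (rule P2s_connected_by_equal_links_iff[OF G])
  have deg2: "even_cycle_with_equal_link G x \<or> two_even_cycles_connected_by_equal_link G x
      \<longleftrightarrow> unlike_regular G x 2" for x
    using unlike_regular_imp_even_cycles[OF assms(1)] even_cycles_imp_unlike_regular by blast
  have eig: "bivalent_eigenvector G x l \<longleftrightarrow> x \<in> carrier_vec n \<and>
      (unlike_regular G (($) x) 1 \<and> l = 2 \<or> unlike_regular G (($) x) 2 \<and> l = 4)" for x l
  proof -
    \<comment> \<open>For an unlike-regular labelling, both values occur exactly if \<open>k\<close>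
      is 1 or 2: one direction is the degree bound, the other holds because \<open>k\<close> is
      positive.\<close>
    have values_iff: "x \<in> carrier_vec n \<and> ($) x ` pverts G = {-1, 1} \<and> unlike_regular G (($) x) k
        \<longleftrightarrow> x \<in> carrier_vec n \<and> (k = 1 \<or> k = 2) \<and> unlike_regular G (($) x) k" for k
    proof -
      have "k = 1 \<or> k = 2 \<Longrightarrow> 0 < k" by auto
      then show ?thesis using unlike_regular_values[OF G \<open>pverts G \<noteq> {}\<close>, of "($) x" k]
        unlike_regular_degree[OF assms(1), of "($) x" k] by argo
    qed
    have "bivalent_eigenvector G x l \<longleftrightarrow>
        (\<exists>k. (x \<in> carrier_vec n \<and> ($) x ` pverts G = {-1, 1} \<and> unlike_regular G (($) x) k)
          \<and> l = 2 * real k)"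
      unfolding bivalent_eigenvector_iff[OF G assms(2) \<open>0 < n\<close>] by blast
    also have "\<dots> \<longleftrightarrow> x \<in> carrier_vec n \<and>
        (unlike_regular G (($) x) 1 \<and> l = 2 * real 1 \<or> unlike_regular G (($) x) 2 \<and> l = 2 * real 2)"
      unfolding values_iff by blast
    finally show ?thesis by simp
  qed
  have "bivalent G \<longleftrightarrow> (\<exists>x. unlike_regular G x 1 \<or> unlike_regular G x 2)"
  proof
    assume "\<exists>x. unlike_regular G x 1 \<or> unlike_regular G x 2"
    then obtain x where x: "unlike_regular G x 1 \<or> unlike_regular G x 2" by blast
    \<comment> \<open>The labelling \<open>x\<close> is defined on all natural numbers; truncating
      it to a vector of dimension \<open>n\<close> keeps its values on the vertices.\<close>
    have "unlike_regular G (($) (vec n x)) k \<longleftrightarrow> unlike_regular G x k" for k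
      using assms(2) by (intro unlike_regular_cong[OF G]) simp
    then show "bivalent G" unfolding bivalent_def eig using x by (metis vec_carrier)
  qed (auto simp: bivalent_def eig)
  then show ?thesis unfolding eig deg1[symmetric] deg2[symmetric] by blast
qed

end
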